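(* For every $n=0,1,2,\dots$ and every $z\in\mathbb{H}$, the function $z\mapsto z^n$ from $\mathbb{H}$ to $\mathbb{H}$ is $\mathbb{H}$-differentiable at $z$, and its $\mathbb{H}$-derivative there is $$(z^n)'=n z^{n-1},$$ where for $n=0$ the right-hand side is understood to be $0$.
   Context: $\mathbb{H}$ denotes the algebra of real quaternions with its usual norm $|\cdot|$. A quaternion function $f$ defined on a neighborhood $G\subset\mathbb{H}$ of a point $z^0$ is called $\mathbb{H}$-differentiable at $z^0$ if there exist two (finite or infinite) sequences of quaternions $A_k=A_k(z^0)$, $B_k=B_k(z^0)$ such that $\sum_k A_kB_k$ is finite (converges) and, for $z^0+h\in G$, $$f(z^0+h)-f(z^0)=\sum_k A_k\, h\, B_k+\omega(z^0,h),\qquad \lim_{h\to0}\frac{|\omega(z^0,h)|}{|h|}=0.$$ In this case the quaternion $f'(z^0)=\sum_k A_kB_k$ is called the $\mathbb{H}$-derivative of $f$ at $z^0$. *)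

theory Defs
  imports "HOL-Analysis.Analysis"
begin

section \<open>The real quaternions\<close>

text \<open>\<open>Quat a b c d\<close> is the quaternion \<open>a + b i + c j + d k\<close>.\<close>

datatype quat = Quat (Re0: real) (Im1: real) (Im2: real) (Im3: real)

lemma quat_eq_iff:
  "x = y \<longleftrightarrow> Re0 x = Re0 y \<and> Im1 x = Im1 y \<and> Im2 x = Im2 y \<and> Im3 x = Im3 y"
  by (cases x; cases y) simp

instantiation quat :: real_vector
begin

definition zero_quat :: quat where
  "0 = Quat 0 0 0 0"

definition plus_quat :: "quat \<Rightarrow> quat \<Rightarrow> quat" where
  "x + y = Quat (Re0 x + Re0 y) (Im1 x + Im1 y) (Im2 x + Im2 y) (Im3 x + Im3 y)"

definition minus_quat :: "quat \<Rightarrow> quat \<Rightarrow> quat" where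
  "x - y = Quat (Re0 x - Re0 y) (Im1 x - Im1 y) (Im2 x - Im2 y) (Im3 x - Im3 y)"

definition uminus_quat :: "quat \<Rightarrow> quat" where
  "- x = Quat (- Re0 x) (- Im1 x) (- Im2 x) (- Im3 x)"

definition scaleR_quat :: "real \<Rightarrow> quat \<Rightarrow> quat" where
  "r *\<^sub>R x = Quat (r * Re0 x) (r * Im1 x) (r * Im2 x) (r * Im3 x)"

instance
  by standard (simp_all add: quat_eq_iff zero_quat_def plus_quat_def minus_quat_def uminus_quat_def
    scaleR_quat_def algebra_simps)

end

instantiation quat :: real_inner
begin

definition inner_quat :: "quat \<Rightarrow> quat \<Rightarrow> real" where
  "x \<bullet> y = Re0 x * Re0 y + Im1 x * Im1 y + Im2 x * Im2 y + Im3 x * Im3 y"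

definition norm_quat :: "quat \<Rightarrow> real" where
  "norm x = sqrt ((Re0 x)\<^sup>2 + (Im1 x)\<^sup>2 + (Im2 x)\<^sup>2 + (Im3 x)\<^sup>2)"

definition sgn_quat :: "quat \<Rightarrow> quat" where
  "sgn x = x /\<^sub>R norm x" for x :: quat

definition dist_quat :: "quat \<Rightarrow> quat \<Rightarrow> real" where
  "dist x y = norm (x - y)" for x y :: quat

definition uniformity_quat :: "(quat \<times> quat) filter" where
  "uniformity = (INF e\<in>{0<..}. principal {(x :: quat, y). dist x y < e})"

definition open_quat :: "quat set \<Rightarrow> bool" where
  "open U \<longleftrightarrow> (\<forall>x\<in>U. eventually (\<lambda>(x', y). x' = x \<longrightarrow> y \<in> U) uniformity)"
  for U :: "quat set"

instance
proof
  fix x y z :: quat and r :: real and U :: "quat set"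
  note defs = quat_eq_iff zero_quat_def plus_quat_def scaleR_quat_def inner_quat_def
  show "x \<bullet> y = y \<bullet> x" "(x + y) \<bullet> z = x \<bullet> z + y \<bullet> z" "(r *\<^sub>R x) \<bullet> y = r * (x \<bullet> y)"
    by (simp_all add: defs algebra_simps)
  show "0 \<le> x \<bullet> x"
    by (simp add: inner_quat_def)
  show "x \<bullet> x = 0 \<longleftrightarrow> x = 0"
    by (simp add: defs add_nonneg_eq_0_iff)
  show "norm x = sqrt (x \<bullet> x)"
    by (simp add: norm_quat_def inner_quat_def power2_eq_square)
qed (fact sgn_quat_def dist_quat_def uniformity_quat_def open_quat_def)+

end

instantiation quat :: real_normed_div_algebra
begin

definition one_quat :: quat where
  "1 = Quat 1 0 0 0"

definition times_quat :: "quat \<Rightarrow> quat \<Rightarrow> quat" where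
  "x * y = Quat
     (Re0 x * Re0 y - Im1 x * Im1 y - Im2 x * Im2 y - Im3 x * Im3 y)
     (Re0 x * Im1 y + Im1 x * Re0 y + Im2 x * Im3 y - Im3 x * Im2 y)
     (Re0 x * Im2 y - Im1 x * Im3 y + Im2 x * Re0 y + Im3 x * Im1 y)
     (Re0 x * Im3 y + Im1 x * Im2 y - Im2 x * Im1 y + Im3 x * Re0 y)"

definition inverse_quat :: "quat \<Rightarrow> quat" where
  "inverse x = Quat (Re0 x) (- Im1 x) (- Im2 x) (- Im3 x) /\<^sub>R (norm x)\<^sup>2"

definition divide_quat :: "quat \<Rightarrow> quat \<Rightarrow> quat" where
  "x div y = x * inverse y" for x y :: quat

instance
proof
  fix x y z :: quat
  note defs = quat_eq_iff zero_quat_def one_quat_def plus_quat_def scaleR_quat_def times_quat_def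
  show "x * y * z = x * (y * z)" "(x + y) * z = x * z + y * z" "x * (y + z) = x * y + x * z"
    "1 * x = x" "x * 1 = x" "(0::quat) \<noteq> 1"
    by (simp_all add: defs algebra_simps)
  show scale: "r *\<^sub>R x * y = r *\<^sub>R (x * y)" "x * r *\<^sub>R y = r *\<^sub>R (x * y)" for r and x y :: quat
    by (simp_all add: defs algebra_simps)
  have n: "(norm w)\<^sup>2 = (Re0 w)\<^sup>2 + (Im1 w)\<^sup>2 + (Im2 w)\<^sup>2 + (Im3 w)\<^sup>2" for w :: quat
    by (simp add: norm_quat_def)
  show "inverse x * x = 1" "x * inverse x = 1" if "x \<noteq> 0"
  proof -
    define c where "c = Quat (Re0 x) (- Im1 x) (- Im2 x) (- Im3 x)"
    have "c * x = (norm x)\<^sup>2 *\<^sub>R 1" "x * c = (norm x)\<^sup>2 *\<^sub>R 1"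
      unfolding n c_def by (simp_all add: defs power2_eq_square)
    moreover have "inverse x * x = (c * x) /\<^sub>R (norm x)\<^sup>2" "x * inverse x = (x * c) /\<^sub>R (norm x)\<^sup>2"
      unfolding inverse_quat_def c_def [symmetric] by (simp_all only: scale)
    ultimately show "inverse x * x = 1" "x * inverse x = 1"
      using that by simp_all
  qed
  show "x div y = x * inverse y"
    by (simp add: divide_quat_def)
  show "inverse (0::quat) = 0"
    by (simp add: inverse_quat_def)
  have "(norm (x * y))\<^sup>2 = (norm x * norm y)\<^sup>2"
    unfolding power_mult_distrib n times_quat_def quat.sel by algebra
  then show "norm (x * y) = norm x * norm y"
    by (simp add: power2_eq_iff_nonneg)
qed

end


section \<open>\<open>\<bbbH>\<close>-differentiability\<close>

text \<open>
  \<open>has_H_derivative f G z D\<close>: the function \<open>f\<close> with domain \<open>G\<close> is \<open>\<bbbH>\<close>-differentiable at \<open>z\<close>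
  with \<open>D = \<Sum>\<^sub>k A\<^sub>k B\<^sub>k\<close> for some admissible \<open>A\<close>, \<open>B\<close>.  A finite sequence of pairs \<open>(A\<^sub>k, B\<^sub>k)\<close> is
  represented by its extension by zeros.  The series \<open>\<Sum>\<^sub>k A\<^sub>k h B\<^sub>k\<close>
  is part of the expansion, so it is required to converge whenever \<open>z + h \<in> G\<close>.  The values of the
  remainder \<open>\<omega> h\<close> for \<open>z + h \<notin> G\<close> are irrelevant, since \<open>G\<close> is a neighbourhood of \<open>z\<close>.
\<close>

definition has_H_derivative :: "(quat \<Rightarrow> quat) \<Rightarrow> quat set \<Rightarrow> quat \<Rightarrow> quat \<Rightarrow> bool" where
  "has_H_derivative f G z D \<longleftrightarrow> z \<in> interior G \<and>
     (\<exists>(A :: nat \<Rightarrow> quat) (B :: nat \<Rightarrow> quat) (\<omega> :: quat \<Rightarrow> quat).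
        (\<lambda>k. A k * B k) sums D \<and>
        (\<forall>h. z + h \<in> G \<longrightarrow>
           summable (\<lambda>k. A k * h * B k) \<and>
           f (z + h) - f z = (\<Sum>k. A k * h * B k) + \<omega> h) \<and>
        ((\<lambda>h. norm (\<omega> h) / norm h) \<longlongrightarrow> 0) (at 0))"

definition H_differentiable :: "(quat \<Rightarrow> quat) \<Rightarrow> quat set \<Rightarrow> quat \<Rightarrow> bool" where
  "H_differentiable f G z \<longleftrightarrow> (\<exists>D. has_H_derivative f G z D)"

definition H_deriv :: "(quat \<Rightarrow> quat) \<Rightarrow> quat set \<Rightarrow> quat \<Rightarrow> quat" where
  "H_deriv f G z = (THE D. has_H_derivative f G z D)"

text \<open>
  The derivative does not depend on the choice of \<open>A\<close> and \<open>B\<close>: it is the limit of the difference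
  quotients along real increments, which commute with all \<open>A\<^sub>k\<close>.
\<close>

lemma has_H_derivative_imp_has_vector_derivative:
  assumes "has_H_derivative f G z D"
  shows "((\<lambda>t. f (z + of_real t)) has_vector_derivative D) (at 0)"
proof -
  obtain A B \<omega> where G: "z \<in> interior G" and D: "(\<lambda>k. A k * B k) sums D"
    and exp: "\<And>h. z + h \<in> G \<Longrightarrow> f (z + h) - f z = (\<Sum>k. A k * h * B k) + \<omega> h"
    and lim: "((\<lambda>h. norm (\<omega> h) / norm h) \<longlongrightarrow> 0) (at 0)"
    using assms unfolding has_H_derivative_def by blast
  have "((\<lambda>t. of_real t :: quat) \<longlongrightarrow> of_real 0) (at 0)"
    by (intro tendsto_intros)
  then have flim: "filterlim (\<lambda>t. of_real t :: quat) (at 0) (at (0::real))"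
    by (auto simp: filterlim_at eventually_at_filter)
  have "((\<lambda>t. z + of_real t) \<longlongrightarrow> z + of_real 0) (at (0::real))"
    by (intro tendsto_intros)
  then have ev: "\<forall>\<^sub>F t in at (0::real). z + of_real t \<in> interior G"
    using G by (intro topological_tendstoD) auto
  have "((\<lambda>t. norm (\<omega> (of_real t)) / norm (of_real t :: quat)) \<longlongrightarrow> 0) (at (0::real))"
    by (rule filterlim_compose[OF lim flim])
  then have "((\<lambda>t. norm (f (z + of_real t) - f z - t *\<^sub>R D) / norm t) \<longlongrightarrow> 0) (at (0::real))"
  proof (rule Lim_transform_eventually)
    show "\<forall>\<^sub>F t in at (0::real). norm (\<omega> (of_real t)) / norm (of_real t :: quat) =
        norm (f (z + of_real t) - f z - t *\<^sub>R D) / norm t"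
      using ev
    proof eventually_elim
      case (elim t)
      have "(\<lambda>k. A k * of_real t * B k) = (\<lambda>k. t *\<^sub>R (A k * B k))"
        by (simp add: of_real_def)
      then have "(\<Sum>k. A k * of_real t * B k) = t *\<^sub>R D"
        using sums_unique[OF sums_scaleR_right[OF D, of t]] by simp
      then show ?case
        using exp[of "of_real t"] elim interior_subset[of G] by auto
    qed
  qed
  then show ?thesis
    by (simp add: has_vector_derivative_def has_derivative_iff_norm bounded_linear_scaleR_left)
qed

lemma has_H_derivative_unique:
  assumes "has_H_derivative f G z D" "has_H_derivative f G z D'"
  shows "D = D'"
  using assms[THEN has_H_derivative_imp_has_vector_derivative] by (rule vector_derivative_unique_at)

lemma H_deriv_eqI: "has_H_derivative f G z D \<Longrightarrow> H_deriv f G z = D"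
  unfolding H_deriv_def by (blast intro: has_H_derivative_unique)

end

theory Submission
  imports Defs
begin

text \<open>
  By the Leibniz rule in the noncommutative algebra \<open>\<bbbH>\<close>, the real derivative of \<open>w ^ n\<close> at \<open>z\<close>
  is \<open>h \<mapsto> (\<Sum>k<n. z ^ k * h * z ^ (n - 1 - k))\<close>. This is already of the required form,
  and each of the \<open>n\<close> products \<open>A\<^sub>k B\<^sub>k\<close> equals \<open>z ^ (n - 1)\<close>.
\<close>

lemma has_derivative_power_noncomm:
  fixes z :: "'a :: real_normed_algebra_1"
  shows "((\<lambda>w. w ^ n) has_derivative (\<lambda>h. \<Sum>k<n. z ^ k * h * z ^ (n - 1 - k))) (at z)"
proof (induction n)
  case (Suc n)
  have "((\<lambda>w. w * w ^ n) has_derivative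
      (\<lambda>h. z * (\<Sum>k<n. z ^ k * h * z ^ (n - 1 - k)) + h * z ^ n)) (at z)"
    by (intro has_derivative_mult has_derivative_ident Suc)
  \<comment> \<open>\<open>h * z ^ n\<close> is the summand for \<open>k = 0\<close>; the left
    factor \<open>z\<close> shifts the others by one.\<close>
  then show ?case
    by (simp add: sum.lessThan_Suc_shift sum_distrib_left mult.assoc add.commute del: sum.lessThan_Suc)
qed simp

text \<open>Padding \<open>A\<close> with zeros turns the finite sum into a convergent series;
  \<open>\<omega>\<close> is the Frechet remainder.\<close>

lemma has_H_derivative_finite_sum:
  fixes n :: nat
  assumes z: "z \<in> interior G"
    and f: "(f has_derivative (\<lambda>h. \<Sum>k<n. A k * h * B k)) (at z)"
  shows "has_H_derivative f G z (\<Sum>k<n. A k * B k)"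
proof -
  define A' where "A' k = (if k < n then A k else 0)" for k
  have sums: "(\<lambda>k. A' k * h * B k) sums (\<Sum>k<n. A k * h * B k)" for h
    using sums_finite[of "{..<n}" "\<lambda>k. A' k * h * B k"] by (simp add: A'_def)
  show ?thesis
    unfolding has_H_derivative_def
  proof (intro conjI exI allI impI)
    \<comment> \<open>The derivative is the value of the linear part at
      \<open>h = 1\<close>.\<close>
    show "(\<lambda>k. A' k * B k) sums (\<Sum>k<n. A k * B k)"
      using sums[of 1] by simp
    show "((\<lambda>h. norm (f (z + h) - f z - (\<Sum>k<n. A k * h * B k)) / norm h) \<longlongrightarrow> 0) (at 0)"
      using f by (simp add: has_derivative_at)
  qed (use z sums in \<open>auto simp: sums_iff\<close>)
qed

theorem proposition2p2:
  fixes n :: nat and z :: quat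
  shows "H_differentiable (\<lambda>w. w ^ n) UNIV z \<and>
         H_deriv (\<lambda>w. w ^ n) UNIV z = (if n = 0 then 0 else of_nat n * z ^ (n - 1))"
proof -
  \<comment> \<open>For \<open>n = 0\<close> both sides vanish, although \<open>z ^ (n - 1)\<close>
    is then \<open>1\<close>.\<close>
  have "(\<Sum>k<n. z ^ k * z ^ (n - 1 - k)) = of_nat n * z ^ (n - 1)"
    by (simp flip: power_add)
  then have "has_H_derivative (\<lambda>w. w ^ n) UNIV z (of_nat n * z ^ (n - 1))"
    using has_H_derivative_finite_sum[OF _ has_derivative_power_noncomm, of z UNIV n] by simp
  then show ?thesis
    by (auto simp: H_differentiable_def dest: H_deriv_eqI)
qed

end
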